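(* Consider a nonlinear LC network with $k$ inductors and $p$ capacitors, $b=k+p$, whose Birkhoffian on the $m$-dimensional configuration space $M_{\mathfrak c}$ has, in the coordinates $q=(q^1,\dots,q^m)$, the components $$\mathfrak{Q}_j(q,\dot q,\ddot q)=\sum_{a=1}^{k}\mathcal N^a_j\,L_a\Big(\sum_{l=1}^m\mathcal N^a_l\dot q^l\Big)\sum_{i=1}^m\mathcal N^a_i\ddot q^i+\sum_{\alpha=k+1}^{b}\mathcal N^\alpha_j\,C_{\alpha-k}\Big(\sum_{l=1}^m\mathcal N^\alpha_lq^l+\mathcal K^\alpha\Big),\qquad j=1,\dots,m.$$ Assume that $$\det\Big[\sum_{a=1}^k\mathcal N^a_j\mathcal N^a_i\,L_a\Big(\sum_{l=1}^m\mathcal N^a_l\dot q^l\Big)\Big]_{j,i=1,\dots,m}\ne0$$ for all $\dot q$. Let $(q_e,0)$ be an equilibrium point of the network. Then $q=q_e$ satisfies the system $$\sum_{\alpha=k+1}^{b}\mathcal N^\alpha_j\,C_{\alpha-k}\Big(\sum_{l=1}^m\mathcal N^\alpha_lq^l+\mathcal K^\alpha\Big)=0,\qquad j=1,\dots,m.$$ A nonlinear LC network can have several equilibrium points. If $$L_a(0)>0\ \text{ for all }a=1,\dots,k,\qquad C'_{\alpha-k}\Big(\sum_{l=1}^m\mathcal N^\alpha_lq_e^l+\mathcal K^\alpha\Big)>0\ \text{ for all }\alpha=k+1,\dots,b,$$ then the equilibrium points $(q_e,0)$ are locally stable centers.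
   Context: Network. An LC network is given by an oriented connected planar graph with $b$ branches, $n+1$ nodes and $m=b-n>0$ independent loops. Each branch carries exactly one device: branches $1,\dots,k$ are inductors and branches $k+1,\dots,b$ are capacitors, $b=k+p$. The devices are nonlinear: $v_{(a)}=L_a(\mathrm i_{(a)})\,d\mathrm i_{(a)}/dt$ for inductor $a$, and $v_\alpha=C_\alpha(\mathrm q_\alpha)$ for capacitor $\alpha$, with $\mathrm q_\alpha$ the charge and $\mathrm i_\alpha=d\mathrm q_\alpha/dt$, where $L_a:\mathbb R\to\mathbb R\setminus\{0\}$ and $C_\alpha:\mathbb R\to\mathbb R$ are smooth functions. $C'_\alpha$ is the derivative of $C_\alpha$. Configuration space. Let $B$ be the $b\times n$ incidence matrix of the graph (one reference node removed; entries $0,\pm1$; rank $n$), so that Kirchhoff's current law is $B^T\mathrm i=0$. For a constant vector $\mathfrak c\in\mathbb R^n$ (corresponding to initial values of certain state variables of the circuit), $M_{\mathfrak c}=\{x\in\mathbb R^b: B^Tx=\mathfrak c\}$, where $\mathrm i=\dot x$. It is an $m$-dimensional affine space, parameterized by coordinates $q\in\mathbb R^m$ through $x=\mathcal Nq+\mathcal K$, where $\mathcal N=(\mathcal N^l_j)$, $l=1,\dots,b$, $j=1,\dots,m$, is a constant $b\times m$ matrix (its columns form a basis of $\ker B^T$) and $\mathcal K=(\mathcal K^l)\in\mathbb R^b$ is a constant vector. Row $l$ corresponds to branch $l$. The Birkhoffian is the 1-form $\sum_j\mathfrak Q_j\,dq^j$; its components are obtained by applying $\mathcal N^T$ to the vector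 of voltage drops (Kirchhoff's voltage law). Dynamics. The motions $q(t)$ are the solutions of $\mathfrak Q_j(q,\dot q,\ddot q)=0$, $j=1,\dots,m$; the state is $(q,\dot q)\in TM_{\mathfrak c}\cong\mathbb R^m\times\mathbb R^m$. Since the determinant is nonzero, the system can be solved for $\ddot q$ and defines a unique second order vector field $Y$ (the Birkhoffian vector field) on $TM_{\mathfrak c}$. An equilibrium point is a point $(q_e,0)$ with $\mathfrak Q_j(q_e,0,0)=0$ for all $j$. It is stable if for every open neighborhood $\Omega$ of $(q_e,0)$ there is a neighborhood $\Omega_1\subset\Omega$ of $(q_e,0)$ such that every motion $(q(t),\dot q(t))$ starting at a point of $\Omega_1$ remains in $\Omega$. A Liapunov function near $(q_e,0)$ is a $C^1$ function $V$ with $V(q_e,0)=0$, $V>0$ on $\Omega\setminus\{(q_e,0)\}$ and $dV(Y)\le0$ on $\Omega$, for some open neighborhood $\Omega$ of $(q_e,0)$. The equilibrium is called a (local) center when there is such a $V$ with $dV(Y)=0$ on $\Omega$ (so that motions near the equilibrium stay on the closed level sets of $V$ surrounding it).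
   Formalization: The stability/center claim additionally assumes that no loop consists of inductors only; without this it is false (two unit inductors and one capacitor C(x)=x in parallel: a constant current circulates and q drifts away), and stability fails whenever such a loop exists. *)

theory Defs
  imports "HOL-Analysis.Analysis" "Graph_Theory.Digraph_Component"
begin

text \<open>
  Index types: the \<open>n + 1\<close> nodes are the elements of \<open>'n option\<close>, with reference node \<open>None\<close>;
  the inductor branches are the \<open>Inl a\<close> with \<open>a :: 'k\<close>, the capacitor branches the \<open>Inr \<alpha>\<close> with
  \<open>\<alpha> :: 'p\<close>; the configuration space has coordinates in \<open>real ^ 'm\<close>.  Parallel branches are
  allowed.
\<close>

section \<open>Networks\<close>

text \<open>Topological planarity of a multigraph; a self-loop would be drawn as a simple closed curve.\<close>

definition planar_drawing ::
    "('v, 'e) pre_digraph \<Rightarrow> ('v \<Rightarrow> complex) \<Rightarrow> ('e \<Rightarrow> real \<Rightarrow> complex) \<Rightarrow> bool" where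
  "planar_drawing G pos \<gamma> \<longleftrightarrow>
     inj_on pos (verts G) \<and>
     (\<forall>e\<in>arcs G. simple_path (\<gamma> e) \<and>
        pathstart (\<gamma> e) = pos (tail G e) \<and> pathfinish (\<gamma> e) = pos (head G e) \<and>
        \<gamma> e ` {0<..<1} \<inter> pos ` verts G = {}) \<and>
     (\<forall>e\<in>arcs G. \<forall>f\<in>arcs G. e \<noteq> f \<longrightarrow> \<gamma> e ` {0<..<1} \<inter> \<gamma> f ` {0<..<1} = {})"

definition planar :: "('v, 'e) pre_digraph \<Rightarrow> bool" where
  "planar G \<longleftrightarrow> (\<exists>pos \<gamma>. planar_drawing G pos \<gamma>)"

definition incidence :: "('n option, 'e) pre_digraph \<Rightarrow> real ^ 'n ^ 'e" where
  "incidence G = (\<chi> e v. (if tail G e = Some v then 1 else 0) - (if head G e = Some v then 1 else 0))"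

definition config_space :: "real ^ 'n ^ 'e \<Rightarrow> real ^ 'n \<Rightarrow> (real ^ 'e) set" where
  "config_space B c = {x. transpose B *v x = c}"

definition smooth_fun :: "(real \<Rightarrow> real) \<Rightarrow> bool" where
  "smooth_fun f \<longleftrightarrow> (\<forall>n x. ((deriv ^^ n) f) differentiable (at x))"

definition lc_network ::
    "('n::finite option, 'k::finite + 'p::finite) pre_digraph \<Rightarrow> real ^ 'n \<Rightarrow>
     real ^ 'm ^ ('k + 'p) \<Rightarrow> real ^ ('k + 'p) \<Rightarrow>
     ('k \<Rightarrow> real \<Rightarrow> real) \<Rightarrow> ('p \<Rightarrow> real \<Rightarrow> real) \<Rightarrow> bool" where
  "lc_network G c N K L C \<longleftrightarrow>
     verts G = UNIV \<and> arcs G = UNIV \<and> Digraph_Component.connected G \<and> planar G \<and>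
     CARD('m) + CARD('n) = CARD('k) + CARD('p) \<and>
     inj (\<lambda>j. column j N) \<and> independent (columns N) \<and>
     span (columns N) = {i. transpose (incidence G) *v i = 0} \<and>
     config_space (incidence G) c = range (\<lambda>q. N *v q + K) \<and>
     (\<forall>a. smooth_fun (L a) \<and> (\<forall>s. L a s \<noteq> 0)) \<and>
     (\<forall>\<alpha>. smooth_fun (C \<alpha>))"

text \<open>
  A nonzero circulating current carried by inductors alone; it exists iff some loop of the graph
  consists of inductors only.
\<close>

definition pure_inductor_current ::
    "('n::finite option, 'k::finite + 'p::finite) pre_digraph \<Rightarrow> real ^ ('k + 'p) \<Rightarrow> bool" where
  "pure_inductor_current G i \<longleftrightarrow>
     i \<noteq> 0 \<and> transpose (incidence G) *v i = 0 \<and> (\<forall>\<alpha>. i $ Inr \<alpha> = 0)"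


section \<open>Dynamics\<close>

definition birkhoffian ::
    "real ^ 'm ^ ('k::finite + 'p::finite) \<Rightarrow> real ^ ('k + 'p) \<Rightarrow>
     ('k \<Rightarrow> real \<Rightarrow> real) \<Rightarrow> ('p \<Rightarrow> real \<Rightarrow> real) \<Rightarrow>
     real ^ 'm \<Rightarrow> real ^ 'm \<Rightarrow> real ^ 'm \<Rightarrow> real ^ 'm" where
  "birkhoffian N K L C q v w = (\<chi> j.
     (\<Sum>a\<in>UNIV. N $ Inl a $ j * L a (\<Sum>l\<in>UNIV. N $ Inl a $ l * v $ l)
                  * (\<Sum>i\<in>UNIV. N $ Inl a $ i * w $ i)) +
     (\<Sum>\<alpha>\<in>UNIV. N $ Inr \<alpha> $ j * C \<alpha> ((\<Sum>l\<in>UNIV. N $ Inr \<alpha> $ l * q $ l) + K $ Inr \<alpha>)))"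

text \<open>
  The Birkhoffian vector field; the description operator is meaningful when the matrix
  multiplying the accelerations is invertible.
\<close>

definition birkhoff_field ::
    "real ^ 'm ^ ('k::finite + 'p::finite) \<Rightarrow> real ^ ('k + 'p) \<Rightarrow>
     ('k \<Rightarrow> real \<Rightarrow> real) \<Rightarrow> ('p \<Rightarrow> real \<Rightarrow> real) \<Rightarrow>
     (real ^ 'm) \<times> (real ^ 'm) \<Rightarrow> (real ^ 'm) \<times> (real ^ 'm)" where
  "birkhoff_field N K L C = (\<lambda>(q, v). (v, THE w. birkhoffian N K L C q v w = 0))"

definition motion ::
    "real ^ 'm ^ ('k::finite + 'p::finite) \<Rightarrow> real ^ ('k + 'p) \<Rightarrow>
     ('k \<Rightarrow> real \<Rightarrow> real) \<Rightarrow> ('p \<Rightarrow> real \<Rightarrow> real) \<Rightarrow>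
     real set \<Rightarrow> (real \<Rightarrow> real ^ 'm) \<Rightarrow> (real \<Rightarrow> real ^ 'm) \<Rightarrow> bool" where
  "motion N K L C I q v \<longleftrightarrow>
     is_interval I \<and> 0 \<in> I \<and>
     (\<exists>w. \<forall>t\<in>I. (q has_vector_derivative v t) (at t within I) \<and>
                (v has_vector_derivative w t) (at t within I) \<and>
                birkhoffian N K L C (q t) (v t) (w t) = 0)"

definition equilibrium ::
    "real ^ 'm ^ ('k::finite + 'p::finite) \<Rightarrow> real ^ ('k + 'p) \<Rightarrow>
     ('k \<Rightarrow> real \<Rightarrow> real) \<Rightarrow> ('p \<Rightarrow> real \<Rightarrow> real) \<Rightarrow> real ^ 'm \<Rightarrow> bool" where
  "equilibrium N K L C q\<^sub>e \<longleftrightarrow> birkhoffian N K L C q\<^sub>e 0 0 = 0"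

definition stable_equilibrium ::
    "real ^ 'm ^ ('k::finite + 'p::finite) \<Rightarrow> real ^ ('k + 'p) \<Rightarrow>
     ('k \<Rightarrow> real \<Rightarrow> real) \<Rightarrow> ('p \<Rightarrow> real \<Rightarrow> real) \<Rightarrow> real ^ 'm \<Rightarrow> bool" where
  "stable_equilibrium N K L C q\<^sub>e \<longleftrightarrow>
     (\<forall>\<Omega>. open \<Omega> \<and> (q\<^sub>e, 0) \<in> \<Omega> \<longrightarrow>
       (\<exists>\<Omega>\<^sub>1. open \<Omega>\<^sub>1 \<and> (q\<^sub>e, 0) \<in> \<Omega>\<^sub>1 \<and> \<Omega>\<^sub>1 \<subseteq> \<Omega> \<and>
         (\<forall>I q v. motion N K L C I q v \<and> (q 0, v 0) \<in> \<Omega>\<^sub>1 \<longrightarrow>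
            (\<forall>t\<in>I. 0 \<le> t \<longrightarrow> (q t, v t) \<in> \<Omega>))))"

definition liapunov_function ::
    "('z::real_normed_vector \<Rightarrow> 'z) \<Rightarrow> 'z \<Rightarrow> 'z set \<Rightarrow> ('z \<Rightarrow> real) \<Rightarrow> ('z \<Rightarrow> 'z \<Rightarrow>\<^sub>L real) \<Rightarrow> bool" where
  "liapunov_function Y z\<^sub>e \<Omega> V dV \<longleftrightarrow>
     open \<Omega> \<and> z\<^sub>e \<in> \<Omega> \<and>
     (\<forall>z\<in>\<Omega>. (V has_derivative blinfun_apply (dV z)) (at z)) \<and> continuous_on \<Omega> dV \<and>
     V z\<^sub>e = 0 \<and> (\<forall>z\<in>\<Omega> - {z\<^sub>e}. V z > 0) \<and> (\<forall>z\<in>\<Omega>. blinfun_apply (dV z) (Y z) \<le> 0)"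

definition local_center :: "('z::real_normed_vector \<Rightarrow> 'z) \<Rightarrow> 'z \<Rightarrow> bool" where
  "local_center Y z\<^sub>e \<longleftrightarrow>
     (\<exists>\<Omega> V dV. liapunov_function Y z\<^sub>e \<Omega> V dV \<and> (\<forall>z\<in>\<Omega>. blinfun_apply (dV z) (Y z) = 0))"

text \<open>
  Whatever the devices are, a loop made of inductors only destroys stability: a constant
  current can circulate in it while the corresponding coordinate drifts off.  Stability results
  therefore have to exclude such loops.
\<close>

lemma not_stable_if_pure_inductor_current:
  fixes N :: "real ^ 'm ^ ('k::finite + 'p::finite)"
  assumes net: "lc_network G c N K L C"
    and eq: "equilibrium N K L C q\<^sub>e"
    and pure: "pure_inductor_current G i"
  shows "\<not> stable_equilibrium N K L C q\<^sub>e"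
proof
  assume st: "stable_equilibrium N K L C q\<^sub>e"
  have "span (columns N) \<subseteq> range ((*v) N)"
  proof (rule span_minimal)
    show "columns N \<subseteq> range ((*v) N)"
      by (auto simp: columns_image_basis)
    show "subspace (range ((*v) N))"
      by (intro linear_subspace_image matrix_vector_mul_linear subspace_UNIV)
  qed
  moreover have "i \<in> span (columns N)" "i \<noteq> 0" and i0: "\<And>\<alpha>. i $ Inr \<alpha> = 0"
    using net pure by (auto simp: lc_network_def pure_inductor_current_def)
  ultimately obtain w where w: "i = N *v w" "w \<noteq> 0"
    by (metis (no_types, lifting) imageE matrix_vector_mult_0_right subsetD)
  have "open (ball (q\<^sub>e, 0 :: real ^ 'm) 1)" "(q\<^sub>e, 0 :: real ^ 'm) \<in> ball (q\<^sub>e, 0) 1"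
    by auto
  then obtain \<Omega> where \<Omega>: "open \<Omega>" "(q\<^sub>e, 0) \<in> \<Omega>"
    and stays: "\<And>I q v t. motion N K L C I q v \<Longrightarrow> (q 0, v 0) \<in> \<Omega> \<Longrightarrow> t \<in> I \<Longrightarrow> 0 \<le> t \<Longrightarrow>
                  (q t, v t) \<in> ball (q\<^sub>e, 0) 1"
    using st unfolding stable_equilibrium_def by metis
  then obtain d where d: "d > 0" "ball (q\<^sub>e, 0) d \<subseteq> \<Omega>"
    using open_contains_ball by blast
  define u where "u = (d / (2 * norm w)) *\<^sub>R w"
  have u: "norm u = d / 2"
    using d w by (simp add: u_def)
  have u0: "(\<Sum>l\<in>UNIV. N $ Inr \<alpha> $ l * u $ l) = 0" for \<alpha>
  proof -
    have "(\<Sum>l\<in>UNIV. N $ Inr \<alpha> $ l * w $ l) = 0"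
      using i0[of \<alpha>] w by (simp add: matrix_vector_mult_def)
    then have "d / (2 * norm w) * (\<Sum>l\<in>UNIV. N $ Inr \<alpha> $ l * w $ l) = 0"
      by simp
    then show ?thesis
      by (simp add: u_def sum_distrib_left mult_ac)
  qed
  have same: "(\<Sum>l\<in>UNIV. N $ Inr \<alpha> $ l * (q\<^sub>e + t *\<^sub>R u) $ l) = (\<Sum>l\<in>UNIV. N $ Inr \<alpha> $ l * q\<^sub>e $ l)"
    for \<alpha> t
  proof -
    have "(\<Sum>l\<in>UNIV. N $ Inr \<alpha> $ l * (q\<^sub>e + t *\<^sub>R u) $ l) =
          (\<Sum>l\<in>UNIV. N $ Inr \<alpha> $ l * q\<^sub>e $ l) + t * (\<Sum>l\<in>UNIV. N $ Inr \<alpha> $ l * u $ l)"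
      by (simp add: algebra_simps sum.distrib sum_distrib_left)
    then show ?thesis by (simp add: u0)
  qed
  have "birkhoffian N K L C (q\<^sub>e + t *\<^sub>R u) u 0 = 0" for t
    using eq unfolding equilibrium_def birkhoffian_def same by (simp add: vec_eq_iff)
  then have "motion N K L C UNIV (\<lambda>t. q\<^sub>e + t *\<^sub>R u) (\<lambda>t. u)"
    unfolding motion_def
    by (intro conjI exI[of _ "\<lambda>t. 0"] ballI) (auto intro!: derivative_eq_intros)
  moreover have "(q\<^sub>e, u) \<in> \<Omega>"
    using d u by (intro subsetD[OF d(2)]) (simp add: dist_Pair_Pair)
  ultimately have "(q\<^sub>e + (1 / norm u) *\<^sub>R u, u) \<in> ball (q\<^sub>e, 0) 1"
    using stays[of UNIV "\<lambda>t. q\<^sub>e + t *\<^sub>R u" "\<lambda>t. u" "1 / norm u"] by simp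
  then have "dist q\<^sub>e (q\<^sub>e + (1 / norm u) *\<^sub>R u) < 1"
    using dist_fst_le[of "(q\<^sub>e, 0 :: real ^ 'm)" "(q\<^sub>e + (1 / norm u) *\<^sub>R u, u)"] by simp
  then show False
    using u d by (simp add: dist_norm)
qed

end

theory Submission
  imports Defs
begin

text \<open>
  The energy \<open>V(q, v) = (\<Sum>a. \<integral> s * L\<^sub>a(s)) + (\<Sum>\<alpha>. \<integral> (C\<^sub>\<alpha>(s) - C\<^sub>\<alpha>(x\<^sub>\<alpha>)))\<close>, with the integrals taken up to the
  branch currents \<open>N\<^sub>a \<bullet> v\<close> and from the equilibrium charges \<open>x\<^sub>\<alpha>\<close> up to the branch charges, is a first
  integral: its derivative along \<open>(v, w)\<close> is \<open>v \<bullet> \<QQ>(q, v, w)\<close>, because the constants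
  \<open>C\<^sub>\<alpha>(x\<^sub>\<alpha>)\<close> contribute \<open>v \<bullet> \<QQ>(q\<^sub>e, 0, 0) = 0\<close>.  The sign conditions make every summand have a strict
  local minimum; a common zero \<open>(q, v)\<close> of all summands has \<open>v = 0\<close> by regularity, and \<open>N(q - q\<^sub>e)\<close> is a
  current carried by inductors alone, hence zero.  So \<open>V\<close> is positive definite at the equilibrium, and
  motions cannot cross a small sphere on which \<open>V\<close> exceeds its initial value.
\<close>

section \<open>First integrals with a strict local minimum\<close>

text \<open>A positive derivative at its zero makes \<open>g\<close> negative just left and positive
  just right of \<open>s\<^sub>0\<close>, so by the mean value theorem an antiderivative exceeds its
  value at \<open>s\<^sub>0\<close> on both sides. Continuity provides an antiderivative on the
  whole line.\<close>

lemma strict_min_antiderivative: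
  fixes g :: "real \<Rightarrow> real"
  assumes cont: "continuous_on UNIV g" and zero: "g s\<^sub>0 = 0"
    and deriv: "(g has_real_derivative D) (at s\<^sub>0)" and "D > 0"
  obtains F d where "\<And>s. (F has_real_derivative g s) (at s)" "F s\<^sub>0 = 0" "d > 0"
    "\<And>s. s \<noteq> s\<^sub>0 \<Longrightarrow> \<bar>s - s\<^sub>0\<bar> < d \<Longrightarrow> F s > 0"
proof -
  have "\<exists>F. \<forall>x::real. -\<infinity> < ereal x \<longrightarrow> ereal x < \<infinity> \<longrightarrow> (F has_vector_derivative g x) (at x)"
    by (rule einterval_antiderivative) (use cont in \<open>auto simp: continuous_on_eq_continuous_at\<close>)
  then obtain F\<^sub>0 where F\<^sub>0: "\<And>s. (F\<^sub>0 has_real_derivative g s) (at s)"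
    by (auto simp: has_real_derivative_iff_has_vector_derivative)
  define F where "F s = F\<^sub>0 s - F\<^sub>0 s\<^sub>0" for s
  have F: "(F has_real_derivative g s) (at s)" for s
    unfolding F_def by (auto intro!: derivative_eq_intros F\<^sub>0)
  \<comment> \<open>The derivative at one point compares \<open>g\<close> only with its value at
    \<open>s\<^sub>0\<close>. This is enough: the mean value step needs the sign of
    \<open>g x\<close>, not monotonicity.\<close>
  obtain d1 where d1: "d1 > 0" "\<And>h. h > 0 \<Longrightarrow> h < d1 \<Longrightarrow> g s\<^sub>0 < g (s\<^sub>0 + h)"
    using DERIV_pos_inc_right[OF deriv \<open>D > 0\<close>] by blast
  obtain d2 where d2: "d2 > 0" "\<And>h. h > 0 \<Longrightarrow> h < d2 \<Longrightarrow> g (s\<^sub>0 - h) < g s\<^sub>0"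
    using DERIV_pos_inc_left[OF deriv \<open>D > 0\<close>] by blast
  have "F s > 0" if s: "s \<noteq> s\<^sub>0" "\<bar>s - s\<^sub>0\<bar> < min d1 d2" for s
  proof (cases "s\<^sub>0 < s")
    case True
    then obtain x where x: "s\<^sub>0 < x" "x < s" "F s - F s\<^sub>0 = (s - s\<^sub>0) * g x"
      using MVT2[of s\<^sub>0 s F g] F by blast
    with d1(2)[of "x - s\<^sub>0"] s zero have "g x > 0" by auto
    with x True show ?thesis by (simp add: F_def)
  next
    case False
    with s have "s < s\<^sub>0" by simp
    then obtain x where x: "s < x" "x < s\<^sub>0" "F s\<^sub>0 - F s = (s\<^sub>0 - s) * g x"
      using MVT2[of s s\<^sub>0 F g] F by blast
    with d2(2)[of "s\<^sub>0 - x"] s zero have "g x < 0" by auto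
    with x \<open>s < s\<^sub>0\<close> have "(s\<^sub>0 - s) * g x < 0" by (simp add: mult_pos_neg)
    with x show ?thesis by (simp add: F_def)
  qed
  with F d1(1) d2(1) show ?thesis
    by (intro that[of F "min d1 d2"]) (auto simp: F_def)
qed

text \<open>Each summand depends on one linear functional \<open>u i \<bullet> z\<close> and has a
  strict local minimum in that variable. The minimum of the sum is strict in \<open>z\<close>
  because, by \<open>sep\<close>, the functionals jointly distinguish points. The formula for
  \<open>dV\<close> is exported so that it can be evaluated along a vector field.\<close>

lemma ridge_sum_potential:
  fixes u :: "'i::finite \<Rightarrow> 'z::real_inner" and g :: "'i \<Rightarrow> real \<Rightarrow> real"
  assumes cont: "\<And>i. continuous_on UNIV (g i)"
    and zero: "\<And>i. g i (u i \<bullet> z\<^sub>0) = 0"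
    and deriv: "\<And>i. (g i has_real_derivative D i) (at (u i \<bullet> z\<^sub>0))"
    and pos: "\<And>i. D i > 0"
    and sep: "\<And>z. (\<And>i. u i \<bullet> z = 0) \<Longrightarrow> z = 0"
  obtains V :: "'z \<Rightarrow> real" and dV \<Omega> where "open \<Omega>" "z\<^sub>0 \<in> \<Omega>"
    "\<And>z. (V has_derivative blinfun_apply (dV z)) (at z)" "continuous_on UNIV dV"
    "V z\<^sub>0 = 0" "\<And>z. z \<in> \<Omega> - {z\<^sub>0} \<Longrightarrow> V z > 0"
    "\<And>z h. blinfun_apply (dV z) h = (\<Sum>i\<in>UNIV. g i (u i \<bullet> z) * (u i \<bullet> h))"
proof -
  have "\<forall>i. \<exists>F d. (\<forall>s. (F has_real_derivative g i s) (at s)) \<and> F (u i \<bullet> z\<^sub>0) = 0 \<and> d > 0 \<and>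
          (\<forall>s. s \<noteq> u i \<bullet> z\<^sub>0 \<longrightarrow> \<bar>s - u i \<bullet> z\<^sub>0\<bar> < d \<longrightarrow> F s > 0)"
    by (intro allI, rule strict_min_antiderivative[OF cont zero deriv pos]) blast
  then obtain F d where F: "\<And>i s. (F i has_real_derivative g i s) (at s)"
    and F0: "\<And>i. F i (u i \<bullet> z\<^sub>0) = 0" and d: "\<And>i. d i > 0"
    and Fpos: "\<And>i s. s \<noteq> u i \<bullet> z\<^sub>0 \<Longrightarrow> \<bar>s - u i \<bullet> z\<^sub>0\<bar> < d i \<Longrightarrow> F i s > 0"
    by metis
  define V where "V z = (\<Sum>i\<in>UNIV. F i (u i \<bullet> z))" for z
  define dV where "dV z = (\<Sum>i\<in>UNIV. g i (u i \<bullet> z) *\<^sub>R blinfun_inner_left (u i))" for z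
  \<comment> \<open>A finite intersection of open slabs, hence open; on it no summand is
    negative.\<close>
  define \<Omega> where "\<Omega> = (\<Inter>i. {z. \<bar>u i \<bullet> z - u i \<bullet> z\<^sub>0\<bar> < d i})"
  have dV: "blinfun_apply (dV z) h = (\<Sum>i\<in>UNIV. g i (u i \<bullet> z) * (u i \<bullet> h))" for z h
    by (simp add: dV_def blinfun.sum_left blinfun.scaleR_left inner_commute)
  have V: "(V has_derivative blinfun_apply (dV z)) (at z)" for z
  proof -
    have "((\<lambda>z. F i (u i \<bullet> z)) has_derivative (\<lambda>h. g i (u i \<bullet> z) * (u i \<bullet> h))) (at z)" for i
      using has_derivative_compose[of "\<lambda>z. u i \<bullet> z" "\<lambda>h. u i \<bullet> h" z UNIV "F i" "(*) (g i (u i \<bullet> z))"]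
        F[of i "u i \<bullet> z"] by (simp add: has_field_derivative_def bounded_linear_imp_has_derivative
          bounded_linear_inner_right)
    then have "(V has_derivative (\<lambda>h. \<Sum>i\<in>UNIV. g i (u i \<bullet> z) * (u i \<bullet> h))) (at z)"
      unfolding V_def by (intro has_derivative_sum)
    then show ?thesis by (simp add: dV[abs_def])
  qed
  have "continuous_on UNIV dV"
    unfolding dV_def
    by (intro continuous_intros continuous_on_compose2[OF cont]) auto
  moreover have "open \<Omega>"
    unfolding \<Omega>_def by (intro open_INT finite ballI open_Collect_less continuous_intros)
  moreover have "V z > 0" if z: "z \<in> \<Omega> - {z\<^sub>0}" for z
  proof -
    have nonneg: "F i (u i \<bullet> z) \<ge> 0" for i
      using Fpos[of "u i \<bullet> z" i] F0[of i] z by (cases "u i \<bullet> z = u i \<bullet> z\<^sub>0") (auto simp: \<Omega>_def)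
    \<comment> \<open>Some functional tells \<open>z\<close> from \<open>z\<^sub>0\<close>; its
      summand is strictly positive.\<close>
    obtain i where "u i \<bullet> (z - z\<^sub>0) \<noteq> 0"
      using sep[of "z - z\<^sub>0"] z by auto
    with z have "F i (u i \<bullet> z) > 0"
      by (intro Fpos) (auto simp: \<Omega>_def inner_diff_right)
    with nonneg show ?thesis
      unfolding V_def by (intro sum_pos2[of _ i]) auto
  qed
  ultimately show ?thesis
    using V d dV by (intro that[of \<Omega> V dV]) (auto simp: \<Omega>_def V_def F0)
qed

text \<open>Liapunov's barrier argument: a curve leaving a small ball must cross the bounding
  sphere, where \<open>V\<close> is at least a positive minimum, but a curve on a level set keeps
  its smaller initial value.\<close>

lemma level_set_confinement:
  fixes V :: "'z::euclidean_space \<Rightarrow> real"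
  assumes V: "continuous_on UNIV V" "V z\<^sub>0 = 0" "\<forall>z\<in>U - {z\<^sub>0}. V z > 0"
    and U: "open U" "z\<^sub>0 \<in> U" and \<Omega>: "open \<Omega>" "z\<^sub>0 \<in> \<Omega>"
  shows "\<exists>\<Omega>\<^sub>1. open \<Omega>\<^sub>1 \<and> z\<^sub>0 \<in> \<Omega>\<^sub>1 \<and> \<Omega>\<^sub>1 \<subseteq> \<Omega> \<and>
    (\<forall>I z. is_interval I \<and> 0 \<in> I \<and> continuous_on I z \<and> (\<forall>s\<in>I. V (z s) = V (z 0)) \<and> z 0 \<in> \<Omega>\<^sub>1 \<longrightarrow>
       (\<forall>t\<in>I. 0 \<le> (t::real) \<longrightarrow> z t \<in> \<Omega>))"
proof -
  obtain r where r: "r > 0" "cball z\<^sub>0 r \<subseteq> U \<inter> \<Omega>"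
    using open_contains_cball[of "U \<inter> \<Omega>"] open_Int[OF U(1) \<Omega>(1)] U \<Omega> by blast
  have "sphere z\<^sub>0 r \<noteq> {}" using r(1) by simp
  moreover have "continuous_on (sphere z\<^sub>0 r) V" using V(1) continuous_on_subset by blast
  \<comment> \<open>The sphere is compact, lies in \<open>U\<close> and avoids
    \<open>z\<^sub>0\<close>, so the least value \<open>V x\<close> on it is attained and positive.
    It serves as the barrier.\<close>
  ultimately obtain x where x: "x \<in> sphere z\<^sub>0 r" "\<And>y. y \<in> sphere z\<^sub>0 r \<Longrightarrow> V x \<le> V y"
    using continuous_attains_inf[of "sphere z\<^sub>0 r" V] by auto
  have "x \<in> cball z\<^sub>0 r" "x \<noteq> z\<^sub>0" using x(1) r(1) by auto
  then have Vx: "V x > 0" using V(3) r(2) by blast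
  \<comment> \<open>The ball makes a curve start inside the sphere, as the intermediate value
    theorem requires; the other condition puts its level below the barrier.\<close>
  define \<Omega>\<^sub>1 where "\<Omega>\<^sub>1 = ball z\<^sub>0 r \<inter> {z. V z < V x}"
  show ?thesis
  proof (intro exI[of _ \<Omega>\<^sub>1] conjI allI impI ballI)
    show "open \<Omega>\<^sub>1"
      unfolding \<Omega>\<^sub>1_def by (intro open_Int open_ball open_Collect_less V(1) continuous_intros)
    show "z\<^sub>0 \<in> \<Omega>\<^sub>1" "\<Omega>\<^sub>1 \<subseteq> \<Omega>"
      using r V(2) Vx by (auto simp: \<Omega>\<^sub>1_def)
    fix I :: "real set" and z t
    assume asm: "is_interval I \<and> 0 \<in> I \<and> continuous_on I z \<and> (\<forall>s\<in>I. V (z s) = V (z 0)) \<and> z 0 \<in> \<Omega>\<^sub>1"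
      and t: "t \<in> I" "0 \<le> t"
    then have I: "is_interval I" "0 \<in> I" and z: "continuous_on I z" and start: "z 0 \<in> \<Omega>\<^sub>1"
      by blast+
    have sub: "{0..t} \<subseteq> I"
      using I t by (auto intro: mem_is_interval_1_I[of I 0 t])
    show "z t \<in> \<Omega>"
    proof (rule ccontr)
      assume "z t \<notin> \<Omega>"
      then have "dist z\<^sub>0 (z t) \<ge> r" using r(2) by (meson Int_iff linorder_not_le mem_cball less_imp_le subsetD)
      moreover have "dist z\<^sub>0 (z 0) \<le> r" using start by (simp add: \<Omega>\<^sub>1_def)
      moreover have "continuous_on {0..t} (\<lambda>s. dist z\<^sub>0 (z s))"
        by (intro continuous_intros continuous_on_subset[OF z sub])
      ultimately obtain s where s: "0 \<le> s" "s \<le> t" "dist z\<^sub>0 (z s) = r"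
        using IVT'[of "\<lambda>s. dist z\<^sub>0 (z s)" 0 r t] t by auto
      then have "V x \<le> V (z s)" using x(2) by simp
      moreover have "V (z s) = V (z 0)" using asm sub s atLeastAtMost_iff by blast
      ultimately show False using start by (simp add: \<Omega>\<^sub>1_def)
    qed
  qed
qed


lemma sum_UNIV_Plus:
  "(\<Sum>i\<in>(UNIV :: ('a::finite + 'b::finite) set). f i) = (\<Sum>a\<in>UNIV. f (Inl a)) + (\<Sum>b\<in>UNIV. f (Inr b))"
  by (subst UNIV_Plus_UNIV[symmetric], subst sum.Plus) auto


section \<open>The energy of the network\<close>

text \<open>The row \<open>N $ l\<close> is the functional that reads off the current or charge of
  branch \<open>l\<close>. In this form, pairing the Birkhoffian with a velocity gives the power
  branch by branch.\<close>

lemma birkhoffian_eq_sum_rows: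
  "birkhoffian N K L C q v w =
     (\<Sum>a\<in>UNIV. (L a (N $ Inl a \<bullet> v) * (N $ Inl a \<bullet> w)) *\<^sub>R N $ Inl a) +
     (\<Sum>\<alpha>\<in>UNIV. C \<alpha> (N $ Inr \<alpha> \<bullet> q + K $ Inr \<alpha>) *\<^sub>R N $ Inr \<alpha>)"
  by (simp add: birkhoffian_def vec_eq_iff inner_vec_def sum_component mult_ac)

text \<open>The matrix is a weighted sum of the rank-one matrices built from the inductor rows. The
  weights \<open>l\<close> are arbitrary, which covers inductances at any velocity.\<close>

lemma inertia_matrix_vector_mult:
  fixes N :: "real ^ 'm ^ ('k::finite + 'p::finite)"
  shows "(\<chi> j i. \<Sum>a\<in>UNIV. N $ Inl a $ j * N $ Inl a $ i * l a) *v w =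
     (\<Sum>a\<in>UNIV. (l a * (N $ Inl a \<bullet> w)) *\<^sub>R N $ Inl a)"
proof -
  have "(\<Sum>i\<in>UNIV. (\<Sum>a\<in>UNIV. N $ Inl a $ j * N $ Inl a $ i * l a) * w $ i) =
        (\<Sum>a\<in>UNIV. l a * (\<Sum>i\<in>UNIV. N $ Inl a $ i * w $ i) * N $ Inl a $ j)" for j
    by (simp add: sum_distrib_left sum_distrib_right mult_ac)
       (rule sum.swap)
  then show ?thesis
    by (simp add: vec_eq_iff matrix_vector_mult_def inner_vec_def sum_component)
qed

text \<open>The Birkhoffian is affine in \<open>w\<close> with an invertible linear part. Existence
  and uniqueness give meaning to the description operator in \<open>birkhoff_field\<close>.\<close>

lemma ex1_acceleration:
  fixes N :: "real ^ 'm ^ ('k::finite + 'p::finite)"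
  assumes "det (\<chi> j i. \<Sum>a\<in>UNIV. N $ Inl a $ j * N $ Inl a $ i * L a (N $ Inl a \<bullet> v)) \<noteq> 0"
  shows "\<exists>!w. birkhoffian N K L C q v w = 0"
proof -
  define A where "A = (\<chi> j i. \<Sum>a\<in>UNIV. N $ Inl a $ j * N $ Inl a $ i * L a (N $ Inl a \<bullet> v))"
  have "invertible A"
    using assms by (simp add: invertible_det_nz A_def)
  then have "bij ((*v) A)"
    by (simp add: invertible_eq_bij)
  moreover have "birkhoffian N K L C q v w = 0 \<longleftrightarrow>
      A *v w = - (\<Sum>\<alpha>\<in>UNIV. C \<alpha> (N $ Inr \<alpha> \<bullet> q + K $ Inr \<alpha>) *\<^sub>R N $ Inr \<alpha>)" for w
    by (simp add: birkhoffian_eq_sum_rows A_def inertia_matrix_vector_mult eq_neg_iff_add_eq_0)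
  ultimately show ?thesis
    by (simp add: bij_iff)
qed

lemma smooth_fun_has_derivative:
  "smooth_fun f \<Longrightarrow> (f has_real_derivative deriv f x) (at x)"
  unfolding smooth_fun_def
  by (metis DERIV_deriv_iff_real_differentiable funpow_0)

lemma smooth_fun_continuous_on: "smooth_fun f \<Longrightarrow> continuous_on A f"
  by (meson smooth_fun_has_derivative DERIV_isCont continuous_at_imp_continuous_on)

text \<open>Independence is stated for the set \<open>columns N\<close>, in which equal columns
  would merge. Injectivity of the column map lets a relation between indexed columns be read as a
  relation over that set.\<close>

lemma inj_config_parametrization:
  assumes "lc_network G c N K L C" and "N *v x = 0"
  shows "x = 0"
proof -
  have inj: "inj (\<lambda>j. column j N)" and ind: "independent (columns N)"
    using assms(1) by (auto simp: lc_network_def)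
  have "(\<Sum>y\<in>columns N. x $ inv (\<lambda>j. column j N) y *\<^sub>R y) = (\<Sum>j\<in>UNIV. x $ j *\<^sub>R column j N)"
    using inv_f_f[OF inj] by (simp add: columns_def full_SetCompr_eq sum.reindex[OF inj])
  also have "\<dots> = 0"
    using assms(2) by (simp add: matrix_mult_sum scalar_mult_eq_scaleR)
  finally have sum0: "(\<Sum>y\<in>columns N. x $ inv (\<lambda>j. column j N) y *\<^sub>R y) = 0" .
  have "x $ inv (\<lambda>j. column j N) (column j N) = 0" for j
    by (rule independentD[OF ind _ subset_refl sum0]) (auto simp: columns_def full_SetCompr_eq)
  then have "x $ j = 0" for j
    by (metis inv_f_f[OF inj])
  then show ?thesis by (simp add: vec_eq_iff)
qed

text \<open>The last conclusion concerns every triple that solves the equations, so it applies both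
  along motions and to the Birkhoffian vector field. Regularity enters only through the triviality
  of the common kernel of the inductor rows, so any weights \<open>l\<close> will do.\<close>

lemma positive_energy:
  fixes N :: "real ^ 'm ^ ('k::finite + 'p::finite)"
  assumes net: "lc_network G c N K L C"
    and regular: "det (\<chi> j i. \<Sum>a\<in>UNIV. N $ Inl a $ j * N $ Inl a $ i * l a) \<noteq> 0"
    and no_loop: "\<And>i. \<not> pure_inductor_current G i"
    and eq: "equilibrium N K L C q\<^sub>e"
    and L0: "\<And>a. L a 0 > 0"
    and C0: "\<And>\<alpha>. deriv (C \<alpha>) (N $ Inr \<alpha> \<bullet> q\<^sub>e + K $ Inr \<alpha>) > 0"
  obtains V :: "(real ^ 'm) \<times> (real ^ 'm) \<Rightarrow> real" and dV \<Omega> where "open \<Omega>" "(q\<^sub>e, 0) \<in> \<Omega>"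
    "\<And>z. (V has_derivative blinfun_apply (dV z)) (at z)" "continuous_on UNIV dV"
    "V (q\<^sub>e, 0) = 0" "\<And>z. z \<in> \<Omega> - {(q\<^sub>e, 0)} \<Longrightarrow> V z > 0"
    "\<And>q v w. birkhoffian N K L C q v w = 0 \<Longrightarrow> blinfun_apply (dV (q, v)) (v, w) = 0"
proof -
  have smooth: "smooth_fun (L a)" "smooth_fun (C \<alpha>)" for a \<alpha>
    using net by (auto simp: lc_network_def)
  define x where "x \<alpha> = N $ Inr \<alpha> \<bullet> q\<^sub>e + K $ Inr \<alpha>" for \<alpha>
  \<comment> \<open>On pairs \<open>(q, v)\<close>, an inductor functional sees the velocity and a
    capacitor functional the configuration.\<close>
  define u where "u = case_sum (\<lambda>a. (0, N $ Inl a)) (\<lambda>\<alpha>. (N $ Inr \<alpha>, 0))"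
  \<comment> \<open>At an equilibrium the single capacitor voltages
    \<open>C \<alpha> (x \<alpha>)\<close> may be nonzero; only their combinations around loops
    vanish. Subtracting them makes every \<open>g i\<close> zero there.\<close>
  define g where "g = case_sum (\<lambda>a s. s * L a s) (\<lambda>\<alpha> s. C \<alpha> (s + K $ Inr \<alpha>) - C \<alpha> (x \<alpha>))"
  define D where "D = case_sum (\<lambda>a. L a 0) (\<lambda>\<alpha>. deriv (C \<alpha>) (x \<alpha>))"
  have cont: "continuous_on UNIV (g i)" for i
    by (cases i) (auto simp: g_def intro!: continuous_intros
        continuous_on_compose2[OF smooth_fun_continuous_on[OF smooth(2)]]
        smooth_fun_continuous_on[OF smooth(1)])
  have zero: "g i (u i \<bullet> (q\<^sub>e, 0)) = 0" for i
    by (cases i) (auto simp: g_def u_def x_def)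
  have deriv: "(g i has_real_derivative D i) (at (u i \<bullet> (q\<^sub>e, 0)))" for i
  proof (cases i)
    case (Inl a)
    then show ?thesis
      using smooth_fun_has_derivative[OF smooth(1), of a 0]
      by (auto simp: g_def u_def D_def intro!: derivative_eq_intros)
  next
    case (Inr \<alpha>)
    then show ?thesis
      using smooth_fun_has_derivative[OF smooth(2), of \<alpha> "x \<alpha>"]
      by (auto simp: g_def u_def D_def x_def DERIV_shift intro!: derivative_eq_intros)
  qed
  have pos: "D i > 0" for i
    using L0 C0 by (cases i) (auto simp: D_def x_def)
  have sep: "z = 0" if z: "\<And>i. u i \<bullet> z = 0" for z
  proof -
    obtain q v where qv: "z = (q, v)" by force
    have v: "N $ Inl a \<bullet> v = 0" and q: "N $ Inr \<alpha> \<bullet> q = 0" for a \<alpha>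
      using z[of "Inl a"] z[of "Inr \<alpha>"] by (auto simp: qv u_def)
    \<comment> \<open>If no inductor carries current, \<open>v\<close> is in the kernel of the
      inertia matrix.\<close>
    have "(\<chi> j i. \<Sum>a\<in>UNIV. N $ Inl a $ j * N $ Inl a $ i * l a) *v v = 0"
      by (simp add: inertia_matrix_vector_mult v)
    then have "v = 0"
      using regular by (simp add: invertible_det_nz[symmetric] invertible_left_inverse
          matrix_left_invertible_ker)
    have "N *v q \<in> span (columns N)"
      by (simp add: matrix_vector_mult_in_columnspace)
    then have "transpose (incidence G) *v (N *v q) = 0"
      using net by (auto simp: lc_network_def)
    moreover have "(N *v q) $ Inr \<alpha> = 0" for \<alpha>
      using q[of \<alpha>] by (simp add: matrix_vector_mult_def inner_vec_def)
    ultimately have "N *v q = 0"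
      using no_loop[of "N *v q"] by (auto simp: pure_inductor_current_def)
    then have "q = 0" by (rule inj_config_parametrization[OF net])
    with \<open>v = 0\<close> show ?thesis by (simp add: qv zero_prod_def)
  qed
  obtain V :: "_ \<Rightarrow> real" and dV \<Omega> where V: "open \<Omega>" "(q\<^sub>e, 0) \<in> \<Omega>"
    "\<And>z. (V has_derivative blinfun_apply (dV z)) (at z)" "continuous_on UNIV dV"
    "V (q\<^sub>e, 0) = 0" "\<And>z. z \<in> \<Omega> - {(q\<^sub>e, 0)} \<Longrightarrow> V z > 0"
    and dV: "\<And>z h. blinfun_apply (dV z) h = (\<Sum>i\<in>UNIV. g i (u i \<bullet> z) * (u i \<bullet> h))"
    by (rule ridge_sum_potential[of g u "(q\<^sub>e, 0)" D, OF cont zero deriv pos sep], assumption, rule that)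
  have "blinfun_apply (dV (q, v)) (v, w) = 0" if "birkhoffian N K L C q v w = 0" for q v w
  proof -
    \<comment> \<open>The subtracted voltages contribute the second term: with zero acceleration the
      inductor part of the Birkhoffian is absent.\<close>
    have "blinfun_apply (dV (q, v)) (v, w) =
        v \<bullet> birkhoffian N K L C q v w - v \<bullet> birkhoffian N K L C q\<^sub>e 0 0"
      by (simp add: dV sum_UNIV_Plus g_def u_def x_def birkhoffian_eq_sum_rows
          inner_add_right inner_sum_right inner_commute[of v] algebra_simps sum_subtractf)
    with that eq show ?thesis by (simp add: equilibrium_def)
  qed
  with V show ?thesis by (rule that)
qed


section \<open>A network with two equilibria\<close>

lemma smooth_fun_poly: "smooth_fun (poly p)"
proof -
  have "(deriv ^^ n) (poly p) = poly ((pderiv ^^ n) p)" for n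
    by (induction n) (auto intro!: DERIV_imp_deriv ext)
  then show ?thesis
    by (auto simp: smooth_fun_def poly_differentiable)
qed

text \<open>A single loop: the inductor runs from the reference node to the other node and the
  capacitor runs back. Both follow the loop, so a loop current has equal entries.\<close>

definition two_branch_graph :: "(1 option, 1 + 1) pre_digraph" where
  "two_branch_graph = \<lparr>verts = UNIV, arcs = UNIV,
     tail = case_sum (\<lambda>_. None) (\<lambda>_. Some 1), head = case_sum (\<lambda>_. Some 1) (\<lambda>_. None)\<rparr>"

lemma ex_1_plus_1: "(\<exists>x :: 1 + 1. P x) \<longleftrightarrow> P (Inl 1) \<or> P (Inr 1)"
  by (metis num1_eq1 sum.exhaust)

lemma two_branch_graph_connected: "Digraph_Component.connected two_branch_graph"
  unfolding Digraph_Component.connected_def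
proof (rule strongly_connectedI)
  fix u v :: "1 option"
  interpret wf_digraph "with_proj (mk_symmetric two_branch_graph)"
    by unfold_locales (auto simp: mk_symmetric_def two_branch_graph_def)
  have "u = v \<or> (u, v) \<in> parcs (mk_symmetric two_branch_graph)"
    by (cases u; cases v) (auto simp: mk_symmetric_def two_branch_graph_def ex_1_plus_1 num1_eq_iff)
  moreover have "v \<in> verts (with_proj (mk_symmetric two_branch_graph))"
    by (simp add: mk_symmetric_def two_branch_graph_def)
  ultimately show "u \<rightarrow>\<^sup>*\<^bsub>with_proj (mk_symmetric two_branch_graph)\<^esub> v"
    by auto
qed (auto simp: mk_symmetric_def two_branch_graph_def)

lemma two_branch_graph_planar: "planar two_branch_graph"
proof -
  define pos :: "1 option \<Rightarrow> complex" where "pos = case_option 0 (\<lambda>_. 1)"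
  \<comment> \<open>The inductor follows the segment from 0 to 1 and the capacitor returns along a
    parabola, whose interior has positive imaginary part and so misses the segment.\<close>
  define \<gamma> :: "1 + 1 \<Rightarrow> real \<Rightarrow> complex" where
    "\<gamma> = case_sum (\<lambda>_ t. Complex t 0) (\<lambda>_ t. Complex (1 - t) (t * (1 - t)))"
  have "inj_on (\<gamma> e) {0..1}" for e
    by (cases e) (auto simp: \<gamma>_def inj_on_def)
  moreover have "path (\<gamma> e)" for e
    by (cases e) (auto simp: \<gamma>_def path_def Complex_eq intro!: continuous_intros)
  ultimately have "simple_path (\<gamma> e)" for e
    by (intro arc_imp_simple_path) (simp add: arc_def)
  moreover have "pathstart (\<gamma> e) = pos (tail two_branch_graph e)"
      "pathfinish (\<gamma> e) = pos (head two_branch_graph e)" for e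
    by (cases e; simp add: \<gamma>_def pos_def two_branch_graph_def pathstart_def pathfinish_def complex_eq_iff)+
  moreover have "\<gamma> e t \<noteq> pos v" if "t \<in> {0<..<1}" for e t v
    using that by (cases e; cases v) (auto simp: \<gamma>_def pos_def complex_eq_iff)
  moreover have "\<gamma> e s \<noteq> \<gamma> f t" if "e \<noteq> f" "s \<in> {0<..<1}" "t \<in> {0<..<1}" for e f s t
    using that by (cases e; cases f) (auto simp: \<gamma>_def num1_eq_iff)
  moreover have "inj pos"
    by (auto simp: inj_def pos_def num1_eq_iff split: option.splits)
  ultimately have "planar_drawing two_branch_graph pos \<gamma>"
    unfolding planar_drawing_def by (auto simp: two_branch_graph_def)
  then show ?thesis by (auto simp: planar_def)
qed

text \<open>Unit inductance gives the constant determinant 1. The capacitor law is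
  \<open>s^2 - s\<close>, and with all entries of \<open>N\<close> equal to 1 and \<open>K\<close>
  zero the equilibria are its roots 0 and 1.\<close>

lemma lc_network_with_two_equilibria:
  defines "N \<equiv> (\<chi> i j. 1) :: real ^ 1 ^ (1 + 1)"
    and "L \<equiv> (\<lambda>_. poly 1) :: 1 \<Rightarrow> real \<Rightarrow> real" and "C \<equiv> (\<lambda>_. poly [:0, -1, 1:]) :: 1 \<Rightarrow> real \<Rightarrow> real"
  shows "lc_network two_branch_graph 0 N 0 L C"
    and "det (\<chi> j i. \<Sum>a\<in>UNIV. N $ Inl a $ j * N $ Inl a $ i *
            L a (\<Sum>l\<in>UNIV. N $ Inl a $ l * v $ l)) \<noteq> 0"
    and "equilibrium N 0 L C 0" "equilibrium N 0 L C 1"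
proof -
  \<comment> \<open>Kirchhoff's current law at the one non-reference node. This kernel, the
    multiples of the all-ones vector and the image of the parametrization are the same line.\<close>
  have kernel: "i v* incidence two_branch_graph = 0 \<longleftrightarrow> i $ Inr 1 = i $ Inl 1" for i
    by (auto simp: vec_eq_iff vector_matrix_mult_def incidence_def
        two_branch_graph_def sum_UNIV_Plus)
  have diag: "i $ Inr 1 = i $ Inl 1 \<longleftrightarrow> (\<exists>r. i = r *\<^sub>R (1 :: real ^ (1 + 1)))" for i
    by (auto simp: vec_eq_iff split_sum_all intro: exI[of _ "i $ Inl 1"])
  have col: "column j N = 1" for j
    by (simp add: N_def column_def vec_eq_iff)
  have cols: "columns N = {1}"
    by (auto simp: columns_def col)
  have "N *v q = (q $ 1) *\<^sub>R 1" for q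
    by (simp add: N_def matrix_vector_mult_def vec_eq_iff)
  moreover have "\<exists>q :: real ^ 1. q $ 1 = r" for r
    by (intro exI[of _ "vec r"]) simp
  ultimately have range: "range (\<lambda>q. N *v q + 0) = {i. \<exists>r. i = r *\<^sub>R 1}"
    by (auto simp: image_iff) (metis)
  show "lc_network two_branch_graph 0 N 0 L C"
    unfolding lc_network_def
    using two_branch_graph_connected two_branch_graph_planar
    by (simp add: kernel diag config_space_def range[simplified] cols span_singleton col inj_def
        num1_eq_iff L_def C_def smooth_fun_poly full_SetCompr_eq)
       (simp add: two_branch_graph_def)
qed (auto simp: N_def L_def C_def equilibrium_def birkhoffian_def vec_eq_iff det_1)

section \<open>Equilibrium equations, several equilibria, stability and the center property\<close>

theorem theorem2:
  fixes G :: "('n::finite option, 'k::finite + 'p::finite) pre_digraph"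
    and c :: "real ^ 'n"
    and N :: "real ^ 'm ^ ('k + 'p)"
    and K :: "real ^ ('k + 'p)"
    and L :: "'k \<Rightarrow> real \<Rightarrow> real"
    and C :: "'p \<Rightarrow> real \<Rightarrow> real"
    and q\<^sub>e :: "real ^ 'm"
  assumes network: "lc_network G c N K L C"
    and regular: "\<And>v :: real ^ 'm.
      det (\<chi> j i. \<Sum>a\<in>UNIV. N $ Inl a $ j * N $ Inl a $ i *
                      L a (\<Sum>l\<in>UNIV. N $ Inl a $ l * v $ l)) \<noteq> 0"
    and equilibrium: "equilibrium N K L C q\<^sub>e"
  shows
    "(\<forall>j. (\<Sum>\<alpha>\<in>UNIV. N $ Inr \<alpha> $ j *
              C \<alpha> ((\<Sum>l\<in>UNIV. N $ Inr \<alpha> $ l * q\<^sub>e $ l) + K $ Inr \<alpha>)) = 0)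
     \<and>
     (\<exists>(G' :: (1 option, 1 + 1) pre_digraph) (c' :: real ^ 1) (N' :: real ^ 1 ^ (1 + 1))
        (K' :: real ^ (1 + 1)) (L' :: 1 \<Rightarrow> real \<Rightarrow> real) (C' :: 1 \<Rightarrow> real \<Rightarrow> real).
        lc_network G' c' N' K' L' C' \<and>
        (\<forall>v :: real ^ 1.
           det (\<chi> j i. \<Sum>a\<in>UNIV. N' $ Inl a $ j * N' $ Inl a $ i *
                           L' a (\<Sum>l\<in>UNIV. N' $ Inl a $ l * v $ l)) \<noteq> 0) \<and>
        (\<exists>q\<^sub>1 q\<^sub>2. q\<^sub>1 \<noteq> q\<^sub>2 \<and> equilibrium N' K' L' C' q\<^sub>1 \<and> equilibrium N' K' L' C' q\<^sub>2))
     \<and>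
     ((\<forall>a. L a 0 > 0) \<longrightarrow>
      (\<forall>\<alpha>. deriv (C \<alpha>) ((\<Sum>l\<in>UNIV. N $ Inr \<alpha> $ l * q\<^sub>e $ l) + K $ Inr \<alpha>) > 0) \<longrightarrow>
      \<not> (\<exists>i. pure_inductor_current G i) \<longrightarrow>
      stable_equilibrium N K L C q\<^sub>e \<and> local_center (birkhoff_field N K L C) (q\<^sub>e, 0))"
proof (intro conjI impI)
  show "\<forall>j. (\<Sum>\<alpha>\<in>UNIV. N $ Inr \<alpha> $ j *
              C \<alpha> ((\<Sum>l\<in>UNIV. N $ Inr \<alpha> $ l * q\<^sub>e $ l) + K $ Inr \<alpha>)) = 0"
    using equilibrium by (simp add: equilibrium_def birkhoffian_def vec_eq_iff)
next
  show "\<exists>(G' :: (1 option, 1 + 1) pre_digraph) (c' :: real ^ 1) (N' :: real ^ 1 ^ (1 + 1))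
        (K' :: real ^ (1 + 1)) (L' :: 1 \<Rightarrow> real \<Rightarrow> real) (C' :: 1 \<Rightarrow> real \<Rightarrow> real).
        lc_network G' c' N' K' L' C' \<and>
        (\<forall>v :: real ^ 1.
           det (\<chi> j i. \<Sum>a\<in>UNIV. N' $ Inl a $ j * N' $ Inl a $ i *
                           L' a (\<Sum>l\<in>UNIV. N' $ Inl a $ l * v $ l)) \<noteq> 0) \<and>
        (\<exists>q\<^sub>1 q\<^sub>2. q\<^sub>1 \<noteq> q\<^sub>2 \<and> equilibrium N' K' L' C' q\<^sub>1 \<and> equilibrium N' K' L' C' q\<^sub>2)"
    by (rule exI, rule exI, rule exI, rule exI, rule exI, rule exI,
        intro conjI allI exI, rule lc_network_with_two_equilibria(1),
        rule lc_network_with_two_equilibria(2), rule zero_neq_one,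
        rule lc_network_with_two_equilibria(3), rule lc_network_with_two_equilibria(4))
next
  assume "\<forall>a. L a 0 > 0"
    and "\<forall>\<alpha>. deriv (C \<alpha>) ((\<Sum>l\<in>UNIV. N $ Inr \<alpha> $ l * q\<^sub>e $ l) + K $ Inr \<alpha>) > 0"
    and no_loop: "\<not> (\<exists>i. pure_inductor_current G i)"
  then have L0: "L a 0 > 0" and C0: "deriv (C \<alpha>) (N $ Inr \<alpha> \<bullet> q\<^sub>e + K $ Inr \<alpha>) > 0" for a \<alpha>
    by (auto simp: inner_vec_def)
  have reg: "det (\<chi> j i. \<Sum>a\<in>UNIV. N $ Inl a $ j * N $ Inl a $ i * L a (N $ Inl a \<bullet> v)) \<noteq> 0" for v
    using regular[of v] by (simp add: inner_vec_def)
  from no_loop have no_loop': "\<not> pure_inductor_current G i" for i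
    by blast
  obtain V :: "_ \<Rightarrow> real" and dV \<Omega>\<^sub>0 where \<Omega>\<^sub>0: "open \<Omega>\<^sub>0" "(q\<^sub>e, 0) \<in> \<Omega>\<^sub>0"
    and V: "\<And>z. (V has_derivative blinfun_apply (dV z)) (at z)" "continuous_on UNIV dV"
      "V (q\<^sub>e, 0) = 0" "\<And>z. z \<in> \<Omega>\<^sub>0 - {(q\<^sub>e, 0)} \<Longrightarrow> V z > 0"
    and first_integral: "\<And>q v w. birkhoffian N K L C q v w = 0 \<Longrightarrow>
      blinfun_apply (dV (q, v)) (v, w) = 0"
    by (rule positive_energy[OF network reg no_loop' equilibrium L0 C0]) (rule that)
  show "stable_equilibrium N K L C q\<^sub>e"
    unfolding stable_equilibrium_def
  proof (intro allI impI)
    fix \<Omega> assume "open \<Omega> \<and> (q\<^sub>e, 0 :: real ^ 'm) \<in> \<Omega>"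
    then have \<Omega>: "open \<Omega>" "(q\<^sub>e, 0) \<in> \<Omega>" by auto
    have contV: "continuous_on UNIV V"
      using V(1) by (meson has_derivative_continuous continuous_at_imp_continuous_on)
    have "\<forall>z\<in>\<Omega>\<^sub>0 - {(q\<^sub>e, 0)}. V z > 0"
      using V(4) by blast
    from level_set_confinement[OF contV V(3) this \<Omega>\<^sub>0 \<Omega>] obtain \<Omega>\<^sub>1
      where \<Omega>\<^sub>1: "open \<Omega>\<^sub>1" "(q\<^sub>e, 0) \<in> \<Omega>\<^sub>1" "\<Omega>\<^sub>1 \<subseteq> \<Omega>"
      and confined: "\<forall>I z. is_interval I \<and> 0 \<in> I \<and> continuous_on I z \<and>
        (\<forall>s\<in>I. V (z s) = V (z 0)) \<and> z 0 \<in> \<Omega>\<^sub>1 \<longrightarrow> (\<forall>t\<in>I. 0 \<le> (t::real) \<longrightarrow> z t \<in> \<Omega>)"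
      by (elim exE conjE) (rule that)
    have "(q t, v t) \<in> \<Omega>"
      if mot: "motion N K L C I q v" and start: "(q 0, v 0) \<in> \<Omega>\<^sub>1" and t: "t \<in> I" "0 \<le> t"
      for I q v t
    proof -
      from mot obtain w where I: "is_interval I" "0 \<in> I"
        and q: "\<And>t. t \<in> I \<Longrightarrow> (q has_vector_derivative v t) (at t within I)"
        and v: "\<And>t. t \<in> I \<Longrightarrow> (v has_vector_derivative w t) (at t within I)"
        and w: "\<And>t. t \<in> I \<Longrightarrow> birkhoffian N K L C (q t) (v t) (w t) = 0"
        unfolding motion_def by blast
      have z: "((\<lambda>t. (q t, v t)) has_derivative (\<lambda>h. h *\<^sub>R (v t, w t))) (at t within I)"
        if "t \<in> I" for t
        using has_derivative_Pair[OF q[OF that, unfolded has_vector_derivative_def]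
            v[OF that, unfolded has_vector_derivative_def]] by simp
      \<comment> \<open>Chain rule: \<open>V\<close> has zero derivative along a motion, hence is
        constant on the convex set \<open>I\<close>. Derivatives within \<open>I\<close> allow for
        endpoints.\<close>
      have "((\<lambda>t. V (q t, v t)) has_derivative (\<lambda>h. 0)) (at t within I)" if "t \<in> I" for t
        using has_derivative_compose[OF z[OF that] V(1)] first_integral[OF w[OF that]]
        by (simp add: blinfun.scaleR_right del: scaleR_Pair)
      then have "\<exists>e. \<forall>t\<in>I. V (q t, v t) = e"
        using I(1) by (intro has_derivative_zero_constant is_interval_convex)
      moreover have "continuous_on I (\<lambda>t. (q t, v t))"
        using z by (meson has_derivative_continuous continuous_on_eq_continuous_within)
      ultimately show ?thesis
        using confined[rule_format, of I "\<lambda>t. (q t, v t)" t] start t I by auto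
    qed
    with \<Omega>\<^sub>1 show "\<exists>\<Omega>\<^sub>1. open \<Omega>\<^sub>1 \<and> (q\<^sub>e, 0) \<in> \<Omega>\<^sub>1 \<and> \<Omega>\<^sub>1 \<subseteq> \<Omega> \<and>
         (\<forall>I q v. motion N K L C I q v \<and> (q 0, v 0) \<in> \<Omega>\<^sub>1 \<longrightarrow>
            (\<forall>t\<in>I. 0 \<le> t \<longrightarrow> (q t, v t) \<in> \<Omega>))"
      by blast
  qed
  \<comment> \<open>Unique solvability makes the second component of the field an actual solution of
    the equations at every \<open>z\<close>, so the first integral property applies.\<close>
  have "blinfun_apply (dV z) (birkhoff_field N K L C z) = 0" for z
    using first_integral[OF theI'[OF ex1_acceleration[of N L "snd z", OF reg, of K C "fst z"]]]
    by (simp add: birkhoff_field_def split_beta)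
  with \<Omega>\<^sub>0 V show "local_center (birkhoff_field N K L C) (q\<^sub>e, 0)"
    unfolding local_center_def liapunov_function_def
    by (intro exI[of _ \<Omega>\<^sub>0] exI[of _ V] exI[of _ dV]) (auto intro: continuous_on_subset)
qed

end
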